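(* Let $T>0$, $\alpha>0$, $\beta>0$, $\sigma>0$, $u_1>0$, let $N$ be a positive integer and $R_0\ge 0$, and consider the optimal control problem $$\int_0^T\big(\alpha R(t)+\beta u(t)\big)\,dt\to\inf,\qquad \dot R(t)=-u(t)R(t)+N\sigma^2,\qquad R(0)=R_0,\qquad 0\le u(t)\le u_1 .$$ Assume $\sqrt{\alpha N\sigma^2/\beta}>u_1$. Then the optimal control $\hat u$ has one of the following forms (which one depends on $R_0$ and $T$), for some $0<t_1<t_2<T$: (1.1) $\hat u(t)=0$ for $t\in(0,T)$; (1.2) $\hat u(t)=u_1$ for $t\in(0,t_1)$ and $\hat u(t)=0$ for $t\in(t_1,T)$; (1.3) $\hat u(t)=0$ for $t\in(0,t_1)$, $\hat u(t)=u_1$ for $t\in(t_1,t_2)$, and $\hat u(t)=0$ for $t\in(t_2,T)$. In particular, the optimal control only takes the values $0$ and $u_1$ and has at most two switchings.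
   Context: Admissible controls are functions $u\in L^\infty[0,T]$ with $0\le u(t)\le u_1$ for a.e. $t$ (identified up to a.e. equality); the corresponding state $R$ is the absolutely continuous solution of $\dot R=-uR+N\sigma^2$, $R(0)=R_0$. An optimal control is an admissible control minimizing the integral functional. *)

theory Defs
  imports "HOL-Analysis.Analysis"
begin

definition admissible :: "real \<Rightarrow> real \<Rightarrow> (real \<Rightarrow> real) \<Rightarrow> bool" where
  "admissible T u1 u \<longleftrightarrow>
     set_borel_measurable lebesgue {0..T} u \<and>
     (AE t in lebesgue. t \<in> {0..T} \<longrightarrow> 0 \<le> u t \<and> u t \<le> u1)"

text \<open>R is the absolutely continuous (Caratheodory) solution of
  R' = -u R + N sigma^2, R(0) = R0 on [0,T], written in integral form.\<close>
definition is_state :: "real \<Rightarrow> nat \<Rightarrow> real \<Rightarrow> real \<Rightarrow> (real \<Rightarrow> real) \<Rightarrow> (real \<Rightarrow> real) \<Rightarrow> bool" where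
  "is_state T N \<sigma> R0 u R \<longleftrightarrow>
     continuous_on {0..T} R \<and>
     (\<forall>t\<in>{0..T}. set_integrable lebesgue {0..t} (\<lambda>s. - u s * R s + real N * \<sigma>\<^sup>2) \<and>
        R t = R0 + (LINT s:{0..t}|lebesgue. - u s * R s + real N * \<sigma>\<^sup>2))"

definition cost :: "real \<Rightarrow> real \<Rightarrow> real \<Rightarrow> (real \<Rightarrow> real) \<Rightarrow> (real \<Rightarrow> real) \<Rightarrow> real" where
  "cost T \<alpha> \<beta> u R = (LINT t:{0..T}|lebesgue. \<alpha> * R t + \<beta> * u t)"

definition optimal_control ::
  "real \<Rightarrow> real \<Rightarrow> real \<Rightarrow> real \<Rightarrow> real \<Rightarrow> nat \<Rightarrow> real \<Rightarrow> (real \<Rightarrow> real) \<Rightarrow> bool" where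
  "optimal_control T \<alpha> \<beta> \<sigma> u1 N R0 u \<longleftrightarrow>
     admissible T u1 u \<and>
     (\<exists>R. is_state T N \<sigma> R0 u R \<and>
        (\<forall>v S. admissible T u1 v \<and> is_state T N \<sigma> R0 v S \<longrightarrow>
               cost T \<alpha> \<beta> u R \<le> cost T \<alpha> \<beta> v S))"

end

theory Submission
  imports Defs
begin

text \<open>
  Put \<open>c = N \<sigma>\<^sup>2\<close> and let \<open>q\<close> be the adjoint variable, \<open>q' = u q - \<alpha>\<close>, \<open>q(T) = 0\<close>. Comparing \<open>u\<close>
  with \<open>u + \<epsilon> (w - u)\<close>, where \<open>w\<close> minimizes \<open>(\<beta> - q R) w\<close> pointwise, gives \<open>u = u1\<close> almost
  everywhere on \<open>q R > \<beta>\<close> and \<open>u = 0\<close> almost everywhere on \<open>q R < \<beta>\<close>. The control drops out of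
  the derivative of \<open>g = q R\<close>, so \<open>g\<close> is continuously differentiable, and the hypothesis on \<open>u1\<close>
  makes \<open>g\<close> strictly concave near every critical point with \<open>g \<le> \<beta>\<close>. Hence \<open>g\<close> has no interior
  local minimum at a level \<open>\<le> \<beta>\<close>, so \<open>g \<ge> \<beta>\<close> holds exactly on an interval, with strict
  inequality inside it; this excludes singular arcs. Since \<open>g(T) = 0\<close>, the interval ends before \<open>T\<close>.
\<close>

subsection \<open>Primitives of bounded measurable functions\<close>

text \<open>The bound is imposed at every point, not almost everywhere, so that integrands can be
  estimated pointwise. Admissible controls, which satisfy their bounds only almost everywhere, are
  brought into this form by clamping.\<close>

definition bounded_measurable :: "real \<Rightarrow> (real \<Rightarrow> real) \<Rightarrow> bool" where
  "bounded_measurable T f \<longleftrightarrow>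
     f \<in> borel_measurable (lebesgue_on {0..T}) \<and> (\<exists>M. \<forall>t\<in>{0..T}. \<bar>f t\<bar> \<le> M)"

text \<open>Such an \<open>F\<close> is Lipschitz on the interval with almost everywhere derivative
  \<open>f\<close>. Carrying the density as an explicit argument lets differential equations with
  measurable coefficients be stated in integral form.\<close>

definition primitive_on :: "real \<Rightarrow> (real \<Rightarrow> real) \<Rightarrow> (real \<Rightarrow> real) \<Rightarrow> bool" where
  "primitive_on T F f \<longleftrightarrow>
     bounded_measurable T f \<and> (\<forall>t\<in>{0..T}. F t = F 0 + integral {0..t} f)"

lemma bounded_measurable_const [simp]: "bounded_measurable T (\<lambda>_. c)"
  by (auto simp: bounded_measurable_def)

lemma bounded_measurable_add:
  assumes "bounded_measurable T f" "bounded_measurable T g"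
  shows "bounded_measurable T (\<lambda>t. f t + g t)"
proof -
  obtain M L where "\<forall>t\<in>{0..T}. \<bar>f t\<bar> \<le> M" "\<forall>t\<in>{0..T}. \<bar>g t\<bar> \<le> L"
    using assms by (auto simp: bounded_measurable_def)
  then have "\<forall>t\<in>{0..T}. \<bar>f t + g t\<bar> \<le> M + L"
    by (meson abs_triangle_ineq add_mono order_trans)
  then show ?thesis using assms by (auto simp: bounded_measurable_def)
qed

lemma bounded_measurable_mult:
  assumes "bounded_measurable T f" "bounded_measurable T g"
  shows "bounded_measurable T (\<lambda>t. f t * g t)"
proof -
  obtain M L where "\<forall>t\<in>{0..T}. \<bar>f t\<bar> \<le> M" "\<forall>t\<in>{0..T}. \<bar>g t\<bar> \<le> L"
    using assms by (auto simp: bounded_measurable_def)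
  then have "\<forall>t\<in>{0..T}. \<bar>f t * g t\<bar> \<le> M * L"
    unfolding abs_mult by (meson abs_ge_zero mult_mono order_trans)
  then show ?thesis using assms by (auto simp: bounded_measurable_def)
qed

lemma bounded_measurable_uminus:
  "bounded_measurable T f \<Longrightarrow> bounded_measurable T (\<lambda>t. - f t)"
  using bounded_measurable_mult[of T "\<lambda>_. -1" f] by simp

lemma bounded_measurable_diff:
  "bounded_measurable T f \<Longrightarrow> bounded_measurable T g \<Longrightarrow> bounded_measurable T (\<lambda>t. f t - g t)"
  using bounded_measurable_add[OF _ bounded_measurable_uminus, of T f g] by simp

lemma bounded_measurable_continuous:
  assumes "continuous_on {0..T} f"
  shows "bounded_measurable T f"
proof -
  have "bounded (f ` {0..T})"
    using assms compact_continuous_image compact_imp_bounded by blast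
  then have "\<exists>M. \<forall>t\<in>{0..T}. \<bar>f t\<bar> \<le> M"
    by (auto simp: bounded_iff)
  moreover have "f \<in> borel_measurable (lebesgue_on {0..T})"
    by (rule continuous_imp_measurable_on_sets_lebesgue[OF assms]) simp
  ultimately show ?thesis by (simp add: bounded_measurable_def)
qed

lemmas bounded_measurable_intros =
  bounded_measurable_add bounded_measurable_mult bounded_measurable_diff
  bounded_measurable_uminus bounded_measurable_const

lemma bounded_measurable_absolutely_integrable:
  assumes "bounded_measurable T f" "0 \<le> s" "t \<le> T"
  shows "f absolutely_integrable_on {s..t}"
proof -
  obtain M where M: "\<forall>t\<in>{0..T}. \<bar>f t\<bar> \<le> M"
    using assms by (auto simp: bounded_measurable_def)
  have "f absolutely_integrable_on {0..T}"
    by (rule measurable_bounded_by_integrable_imp_absolutely_integrable[where g="\<lambda>_. M"])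
      (use assms M in \<open>auto simp: bounded_measurable_def\<close>)
  then show ?thesis
    by (rule absolutely_integrable_on_subinterval) (use assms in auto)
qed

lemma bounded_measurable_integrable:
  "bounded_measurable T f \<Longrightarrow> 0 \<le> s \<Longrightarrow> t \<le> T \<Longrightarrow> f integrable_on {s..t}"
  using bounded_measurable_absolutely_integrable set_lebesgue_integral_eq_integral(1) by blast

lemma abs_integral_le:
  fixes f :: "real \<Rightarrow> real"
  assumes "f integrable_on {s..t}" "s \<le> t" "\<And>r. r \<in> {s..t} \<Longrightarrow> \<bar>f r\<bar> \<le> M"
  shows "\<bar>integral {s..t} f\<bar> \<le> M * (t - s)"
proof -
  have "norm (integral {s..t} f) \<le> integral {s..t} (\<lambda>_. M)"
    by (rule integral_norm_bound_integral) (use assms in auto)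
  then show ?thesis using assms by (simp add: mult.commute)
qed

lemma primitive_on_bounded_measurable: "primitive_on T F f \<Longrightarrow> bounded_measurable T f"
  by (simp add: primitive_on_def)

lemma primitive_on_increment:
  assumes "primitive_on T F f" "0 \<le> s" "s \<le> t" "t \<le> T"
  shows "F t - F s = integral {s..t} f"
proof -
  have "integral {0..s} f + integral {s..t} f = integral {0..t} f"
    by (rule Henstock_Kurzweil_Integration.integral_combine)
      (use assms bounded_measurable_integrable[OF primitive_on_bounded_measurable[OF assms(1)]] in auto)
  moreover have "F t = F 0 + integral {0..t} f" "F s = F 0 + integral {0..s} f"
    by (rule assms(1)[unfolded primitive_on_def, THEN conjunct2, rule_format], use assms(2-) in simp)+
  ultimately show ?thesis by simp
qed

lemma primitive_on_lipschitz:
  assumes "primitive_on T F f"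
  obtains L where "L \<ge> 0" "\<And>t. t \<in> {0..T} \<Longrightarrow> \<bar>f t\<bar> \<le> L"
    "\<And>s t. 0 \<le> s \<Longrightarrow> s \<le> t \<Longrightarrow> t \<le> T \<Longrightarrow> \<bar>F t - F s\<bar> \<le> L * (t - s)"
proof -
  obtain M where M: "\<forall>t\<in>{0..T}. \<bar>f t\<bar> \<le> M"
    using primitive_on_bounded_measurable[OF assms] unfolding bounded_measurable_def by blast
  \<comment> \<open>For \<open>T < 0\<close> the interval is empty and \<open>M\<close> may be
    negative; its absolute value gives the nonnegative constant.\<close>
  have f: "\<bar>f t\<bar> \<le> \<bar>M\<bar>" if "t \<in> {0..T}" for t using M that by force
  show thesis
  proof (rule that[of "\<bar>M\<bar>"])
    fix s t assume "0 \<le> s" "s \<le> t" "t \<le> T"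
    then show "\<bar>F t - F s\<bar> \<le> \<bar>M\<bar> * (t - s)"
      using primitive_on_increment[OF assms, of s t] f
      by (auto intro!: abs_integral_le bounded_measurable_integrable
            primitive_on_bounded_measurable[OF assms])
  qed (use f in auto)
qed

lemma primitive_on_continuous:
  assumes "primitive_on T F f"
  shows "continuous_on {0..T} F"
proof -
  obtain L where L: "L \<ge> 0"
    "\<And>s t. 0 \<le> s \<Longrightarrow> s \<le> t \<Longrightarrow> t \<le> T \<Longrightarrow> \<bar>F t - F s\<bar> \<le> L * (t - s)"
    using primitive_on_lipschitz[OF assms] by metis
  have "L-lipschitz_on {0..T} F"
  proof (rule lipschitz_onI)
    fix s t assume "s \<in> {0..T}" "t \<in> {0..T}"
    then show "dist (F s) (F t) \<le> L * dist s t"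
      using L(2)[of s t] L(2)[of t s] by (cases "s \<le> t") (auto simp: dist_real_def abs_minus_commute)
  qed (use L in auto)
  then show ?thesis by (rule lipschitz_on_continuous_on)
qed

section \<open>Product and chain rules via quadratic error bounds\<close>

text \<open>Difference quotients are bounded by \<open>K * \<bar>y - x\<bar>\<close>, so the
  derivative within the interval is zero at every point, which forces a constant.\<close>

lemma constant_of_quadratic_increments:
  fixes P :: "real \<Rightarrow> real"
  assumes "\<And>s t. 0 \<le> s \<Longrightarrow> s \<le> t \<Longrightarrow> t \<le> T \<Longrightarrow> \<bar>P t - P s\<bar> \<le> K * (t - s)\<^sup>2"
    and "t \<in> {0..T}"
  shows "P t = P 0"
proof -
  have "(P has_field_derivative 0) (at x within {0..T})" if x: "x \<in> {0..T}" for x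
  proof -
    have "((\<lambda>y. K * \<bar>y - x\<bar>) \<longlongrightarrow> K * \<bar>x - x\<bar>) (at x within {0..T})"
      by (intro tendsto_intros)
    then have *: "((\<lambda>y. K * \<bar>y - x\<bar>) \<longlongrightarrow> 0) (at x within {0..T})" by simp
    have "((\<lambda>y. (P y - P x) / (y - x)) \<longlongrightarrow> 0) (at x within {0..T})"
    proof (rule tendsto_rabs_zero_cancel, rule tendsto_sandwich[OF _ _ tendsto_const *])
      have "\<bar>(P y - P x) / (y - x)\<bar> \<le> K * \<bar>y - x\<bar>" if "y \<in> {0..T}" "y \<noteq> x" for y
      proof -
        have "\<bar>P y - P x\<bar> \<le> K * (y - x)\<^sup>2"
          using assms(1)[of x y] assms(1)[of y x] x that
          by (cases "x \<le> y") (auto simp: abs_minus_commute power2_commute)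
        then have "\<bar>P y - P x\<bar> \<le> (K * \<bar>y - x\<bar>) * \<bar>y - x\<bar>"
          by (simp add: power2_eq_square mult.assoc flip: abs_mult)
        then show ?thesis using that by (simp add: abs_divide divide_le_eq)
      qed
      then show "\<forall>\<^sub>F y in at x within {0..T}. \<bar>(P y - P x) / (y - x)\<bar> \<le> K * \<bar>y - x\<bar>"
        by (auto simp: eventually_at_filter)
    qed auto
    then show ?thesis by (simp add: has_field_derivative_iff)
  qed
  then obtain c where "\<forall>x\<in>{0..T}. P x = c"
    using has_field_derivative_zero_constant[of "{0..T}" P] by auto
  then show ?thesis using assms(2) by auto
qed

text \<open>Replaces Lebesgue's differentiation theorem in the product and chain rules below.\<close>
lemma primitive_onI_quadratic:
  assumes f: "bounded_measurable T f"
    and "\<And>s t. 0 \<le> s \<Longrightarrow> s \<le> t \<Longrightarrow> t \<le> T \<Longrightarrow> \<bar>F t - F s - integral {s..t} f\<bar> \<le> K * (t - s)\<^sup>2"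
  shows "primitive_on T F f"
proof -
  \<comment> \<open>The trivial \<open>integral {0..0} f\<close> puts the goal in the form
    \<open>P t = P 0\<close> for \<open>P t = F t - integral {0..t} f\<close>.\<close>
  have "F t - integral {0..t} f = F 0 - integral {0..0} f" if "t \<in> {0..T}" for t
  proof (rule constant_of_quadratic_increments[where K=K and T=T])
    fix s t assume st: "0 \<le> s" "s \<le> t" "t \<le> T"
    have "integral {0..s} f + integral {s..t} f = integral {0..t} f"
      by (rule Henstock_Kurzweil_Integration.integral_combine)
        (use st f bounded_measurable_integrable in auto)
    then have "F t - integral {0..t} f - (F s - integral {0..s} f) = F t - F s - integral {s..t} f"
      by simp
    then show "\<bar>F t - integral {0..t} f - (F s - integral {0..s} f)\<bar> \<le> K * (t - s)\<^sup>2"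
      using assms(2)[OF st] by simp
  qed (fact that)
  then have "F t - integral {0..t} f = F 0" if "t \<in> {0..T}" for t
    using that by simp
  then have "F t = F 0 + integral {0..t} f" if "t \<in> {0..T}" for t
    using that by (metis diff_add_cancel)
  then show ?thesis using f unfolding primitive_on_def by blast
qed

text \<open>Freezing the factors \<open>F\<close> and \<open>G\<close> at the left end
  \<open>s\<close> changes the integral over \<open>{s..t}\<close> by an amount quadratic in
  \<open>t - s\<close>, because both functions are Lipschitz. The leftover product of increments is
  quadratic as well.\<close>

lemma primitive_on_mult:
  assumes F: "primitive_on T F f" and G: "primitive_on T G g"
  shows "primitive_on T (\<lambda>t. F t * G t) (\<lambda>t. f t * G t + F t * g t)"
proof -
  have f: "bounded_measurable T f" and g: "bounded_measurable T g"
    using F G primitive_on_bounded_measurable by auto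
  have cF: "bounded_measurable T F" and cG: "bounded_measurable T G"
    using F G by (auto intro: bounded_measurable_continuous primitive_on_continuous)
  obtain L where L: "L \<ge> 0" "\<And>t. t \<in> {0..T} \<Longrightarrow> \<bar>f t\<bar> \<le> L"
    "\<And>s t. 0 \<le> s \<Longrightarrow> s \<le> t \<Longrightarrow> t \<le> T \<Longrightarrow> \<bar>F t - F s\<bar> \<le> L * (t - s)"
    using primitive_on_lipschitz[OF F] by metis
  obtain M where M: "M \<ge> 0" "\<And>t. t \<in> {0..T} \<Longrightarrow> \<bar>g t\<bar> \<le> M"
    "\<And>s t. 0 \<le> s \<Longrightarrow> s \<le> t \<Longrightarrow> t \<le> T \<Longrightarrow> \<bar>G t - G s\<bar> \<le> M * (t - s)"
    using primitive_on_lipschitz[OF G] by metis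
  show ?thesis
  \<comment> \<open>One \<open>L * M\<close> comes from the product of the increments, two from the
    integral of \<open>?e\<close>.\<close>
  proof (rule primitive_onI_quadratic[where K="3 * L * M"])
    show "bounded_measurable T (\<lambda>t. f t * G t + F t * g t)"
      by (intro bounded_measurable_intros f g cF cG)
    fix s t assume st: "0 \<le> s" "s \<le> t" "t \<le> T"
    let ?e = "\<lambda>r. f r * (G r - G s) + g r * (F r - F s)"
    have e: "bounded_measurable T ?e"
      by (intro bounded_measurable_intros f g cF cG)
    have i: "h integrable_on {s..t}" if "bounded_measurable T h" for h
      by (rule bounded_measurable_integrable[OF that]) (use st in auto)
    have "integral {s..t} (\<lambda>r. f r * G r + F r * g r)
        = integral {s..t} (\<lambda>r. ?e r + (f r * G s + g r * F s))"
      by (simp add: algebra_simps)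
    also have "\<dots> = integral {s..t} ?e + (integral {s..t} f * G s + integral {s..t} g * F s)"
      by (simp only: Henstock_Kurzweil_Integration.integral_add i e f g bounded_measurable_intros
          Henstock_Kurzweil_Integration.integral_mult_left)
    also have "\<dots> = integral {s..t} ?e + ((F t - F s) * G s + (G t - G s) * F s)"
      using st by (simp add: primitive_on_increment[OF F] primitive_on_increment[OF G])
    finally have eq: "F t * G t - F s * G s - integral {s..t} (\<lambda>r. f r * G r + F r * g r)
      = (F t - F s) * (G t - G s) - integral {s..t} ?e"
      by (simp add: algebra_simps)
    have "\<bar>(F t - F s) * (G t - G s)\<bar> \<le> (L * (t - s)) * (M * (t - s))"
      unfolding abs_mult using L M st by (intro mult_mono) auto
    moreover have "\<bar>integral {s..t} ?e\<bar> \<le> (2 * L * M * (t - s)) * (t - s)"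
    proof (rule abs_integral_le[OF i[OF e] st(2)])
      fix r assume r: "r \<in> {s..t}"
      have "\<bar>f r * (G r - G s)\<bar> \<le> L * (M * (r - s))"
        unfolding abs_mult using L(1) L(2)[of r] M(3)[of s r] st r by (intro mult_mono) auto
      moreover have "\<bar>g r * (F r - F s)\<bar> \<le> M * (L * (r - s))"
        unfolding abs_mult using M(1) M(2)[of r] L(3)[of s r] st r by (intro mult_mono) auto
      moreover have "(L * M) * (r - s) \<le> (L * M) * (t - s)"
        using r L M by (intro mult_left_mono) auto
      ultimately show "\<bar>?e r\<bar> \<le> 2 * L * M * (t - s)"
        by (auto simp: algebra_simps)
    qed
    ultimately show "\<bar>F t * G t - F s * G s - integral {s..t} (\<lambda>r. f r * G r + F r * g r)\<bar>
        \<le> 3 * L * M * (t - s)\<^sup>2"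
      unfolding eq by (auto simp: power2_eq_square algebra_simps)
  qed
qed

lemma primitive_on_exp:
  assumes F: "primitive_on T F f"
  shows "primitive_on T (\<lambda>t. exp (F t)) (\<lambda>t. f t * exp (F t))"
proof -
  have f: "bounded_measurable T f" using F primitive_on_bounded_measurable by auto
  have c: "continuous_on {0..T} F" by (rule primitive_on_continuous[OF F])
  then have cE: "bounded_measurable T (\<lambda>t. exp (F t))"
    by (intro bounded_measurable_continuous continuous_intros)
  obtain B where B: "\<And>t. t \<in> {0..T} \<Longrightarrow> \<bar>F t\<bar> \<le> B"
    using bounded_measurable_continuous[OF c] unfolding bounded_measurable_def by blast
  obtain L where L: "L \<ge> 0" "\<And>t. t \<in> {0..T} \<Longrightarrow> \<bar>f t\<bar> \<le> L"
    "\<And>s t. 0 \<le> s \<Longrightarrow> s \<le> t \<Longrightarrow> t \<le> T \<Longrightarrow> \<bar>F t - F s\<bar> \<le> L * (t - s)"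
    using primitive_on_lipschitz[OF F] by metis
  have exp_lip: "\<bar>exp x - exp y\<bar> \<le> exp B * \<bar>x - y\<bar>" if "\<bar>x\<bar> \<le> B" "\<bar>y\<bar> \<le> B" for x y :: real
  proof -
    have "norm (exp x - exp y) \<le> exp B * norm (x - y)"
      by (rule field_differentiable_bound[where S="{-B..B}" and f'=exp])
        (use that in \<open>auto intro!: derivative_eq_intros\<close>)
    then show ?thesis by simp
  qed
  show ?thesis
  proof (rule primitive_onI_quadratic[where K="2 * L * L * exp B"])
    show "bounded_measurable T (\<lambda>t. f t * exp (F t))"
      by (intro bounded_measurable_intros f cE)
    fix s t assume st: "0 \<le> s" "s \<le> t" "t \<le> T"
    have "\<exists>x. \<bar>x - F s\<bar> \<le> L * (t - s) \<and> \<bar>x\<bar> \<le> B \<and> exp (F t) - exp (F s) = exp x * (F t - F s)"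
    proof -
      have Fst: "\<bar>F t - F s\<bar> \<le> L * (t - s)" "\<bar>F t\<bar> \<le> B" "\<bar>F s\<bar> \<le> B"
        using st L(3)[of s t] B by auto
      consider "F s < F t" | "F t < F s" | "F s = F t" by linarith
      then show ?thesis
      proof cases
        case 1
        then obtain z where "z > F s" "z < F t" "exp (F t) - exp (F s) = (F t - F s) * exp z"
          using MVT2[of "F s" "F t" exp exp] by (auto intro!: derivative_eq_intros)
        then show ?thesis using Fst by (intro exI[of _ z]) (auto simp: mult.commute)
      next
        case 2
        then obtain z where "z > F t" "z < F s" "exp (F s) - exp (F t) = (F s - F t) * exp z"
          using MVT2[of "F t" "F s" exp exp] by (auto intro!: derivative_eq_intros)
        then show ?thesis using Fst by (intro exI[of _ z]) (auto simp: algebra_simps)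
      next
        case 3
        then show ?thesis using Fst by (intro exI[of _ "F s"]) (use L st in auto)
      qed
    qed
    then obtain x where x: "\<bar>x - F s\<bar> \<le> L * (t - s)" "\<bar>x\<bar> \<le> B"
      "exp (F t) - exp (F s) = exp x * (F t - F s)" by blast
    let ?e = "\<lambda>r. f r * (exp x - exp (F r))"
    have e: "bounded_measurable T ?e"
      by (intro bounded_measurable_intros f cE)
    have i: "h integrable_on {s..t}" if "bounded_measurable T h" for h
      by (rule bounded_measurable_integrable[OF that]) (use st in auto)
    have "exp (F t) - exp (F s) = integral {s..t} (\<lambda>r. f r * exp x)"
      using x st by (simp add: primitive_on_increment[OF F])
    also have "\<dots> = integral {s..t} (\<lambda>r. ?e r + f r * exp (F r))"
      by (simp add: algebra_simps)
    also have "\<dots> = integral {s..t} ?e + integral {s..t} (\<lambda>r. f r * exp (F r))"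
      by (intro Henstock_Kurzweil_Integration.integral_add i e bounded_measurable_intros f cE)
    finally have eq: "exp (F t) - exp (F s) - integral {s..t} (\<lambda>r. f r * exp (F r)) = integral {s..t} ?e"
      by simp
    have "\<bar>integral {s..t} ?e\<bar> \<le> (2 * L * L * exp B * (t - s)) * (t - s)"
    proof (rule abs_integral_le[OF i[OF e] st(2)])
      fix r assume r: "r \<in> {s..t}"
      \<comment> \<open>Both \<open>x\<close> and \<open>F r\<close> lie within
        \<open>L * (t - s)\<close> of \<open>F s\<close>, which explains the factor 2.\<close>
      have "L * (r - s) \<le> L * (t - s)" using r L by (intro mult_left_mono) auto
      then have "\<bar>x - F r\<bar> \<le> 2 * (L * (t - s))"
        using x(1) L(3)[of s r] r st by auto
      then have "exp B * \<bar>x - F r\<bar> \<le> exp B * (2 * (L * (t - s)))" by simp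
      moreover have "\<bar>exp x - exp (F r)\<bar> \<le> exp B * \<bar>x - F r\<bar>"
        using exp_lip[OF x(2), of "F r"] B r st by auto
      ultimately have "\<bar>exp x - exp (F r)\<bar> \<le> exp B * (2 * (L * (t - s)))" by linarith
      then have "\<bar>f r\<bar> * \<bar>exp x - exp (F r)\<bar> \<le> L * (exp B * (2 * (L * (t - s))))"
        using L(1) L(2)[of r] r st by (intro mult_mono) auto
      moreover have "L * (exp B * (2 * (L * (t - s)))) = 2 * L * L * exp B * (t - s)" by simp
      ultimately show "\<bar>?e r\<bar> \<le> 2 * L * L * exp B * (t - s)" by (simp only: abs_mult)
    qed
    then show "\<bar>exp (F t) - exp (F s) - integral {s..t} (\<lambda>r. f r * exp (F r))\<bar>
        \<le> 2 * L * L * exp B * (t - s)\<^sup>2"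
      unfolding eq by (simp add: power2_eq_square algebra_simps)
  qed
qed

lemma primitive_on_integral:
  "bounded_measurable T f \<Longrightarrow> primitive_on T (\<lambda>t. integral {0..t} f) f"
  by (simp add: primitive_on_def)

lemma primitive_on_const: "primitive_on T (\<lambda>_. c) (\<lambda>_. 0)"
  by (simp add: primitive_on_def)

lemma primitive_on_add:
  assumes F: "primitive_on T F f" and G: "primitive_on T G g"
  shows "primitive_on T (\<lambda>t. F t + G t) (\<lambda>t. f t + g t)"
proof (rule primitive_onI_quadratic[where K=0])
  show "bounded_measurable T (\<lambda>t. f t + g t)"
    by (intro bounded_measurable_intros F[THEN primitive_on_bounded_measurable] G[THEN primitive_on_bounded_measurable])
  fix s t assume st: "0 \<le> s" "s \<le> t" "t \<le> T"
  have "integral {s..t} (\<lambda>t. f t + g t) = integral {s..t} f + integral {s..t} g"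
    using st F G by (intro Henstock_Kurzweil_Integration.integral_add bounded_measurable_integrable)
      (auto dest: primitive_on_bounded_measurable)
  then show "\<bar>F t + G t - (F s + G s) - integral {s..t} (\<lambda>t. f t + g t)\<bar> \<le> 0 * (t - s)\<^sup>2"
    using primitive_on_increment[OF F st] primitive_on_increment[OF G st] by simp
qed

lemma primitive_on_cmult:
  assumes F: "primitive_on T F f"
  shows "primitive_on T (\<lambda>t. c * F t) (\<lambda>t. c * f t)"
  using primitive_on_mult[OF primitive_on_const F, of c] by simp

lemma primitive_on_diff:
  assumes "primitive_on T F f" and "primitive_on T G g"
  shows "primitive_on T (\<lambda>t. F t - G t) (\<lambda>t. f t - g t)"
  using primitive_on_add[OF assms(1) primitive_on_cmult[OF assms(2), of "-1"]] by simp

lemma bounded_measurable_cong: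
  assumes f: "bounded_measurable T f" and eq: "\<And>t. t \<in> {0..T} \<Longrightarrow> f t = g t"
  shows "bounded_measurable T g"
proof -
  obtain M where M: "\<forall>t\<in>{0..T}. \<bar>f t\<bar> \<le> M" and f': "f \<in> borel_measurable (lebesgue_on {0..T})"
    using f unfolding bounded_measurable_def by blast
  have "g \<in> borel_measurable (lebesgue_on {0..T})"
    by (rule measurable_cong[THEN iffD1, OF _ f']) (simp add: eq)
  moreover have "\<forall>t\<in>{0..T}. \<bar>g t\<bar> \<le> M"
    using M eq by simp
  ultimately show ?thesis unfolding bounded_measurable_def by blast
qed

lemma primitive_on_cong:
  assumes F: "primitive_on T F f"
    and FG: "\<And>t. t \<in> {0..T} \<Longrightarrow> F t = G t" and fg: "\<And>t. t \<in> {0..T} \<Longrightarrow> f t = g t"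
  shows "primitive_on T G g"
  unfolding primitive_on_def
proof (intro conjI ballI)
  show "bounded_measurable T g"
    by (rule bounded_measurable_cong[OF primitive_on_bounded_measurable[OF F] fg])
  fix t assume t: "t \<in> {0..T}"
  have "integral {0..t} g = integral {0..t} f"
    by (rule Henstock_Kurzweil_Integration.integral_cong) (use t fg in simp)
  moreover have "F t = F 0 + integral {0..t} f"
    using F t unfolding primitive_on_def by blast
  moreover have "F 0 = G 0" "F t = G t" using FG t by auto
  ultimately show "G t = G 0 + integral {0..t} g" by simp
qed

subsection \<open>Linear differential equations with measurable coefficients\<close>

lemma linear_ode_integrating_factor:
  assumes a: "bounded_measurable T a"
  shows "primitive_on T (\<lambda>t. exp (integral {0..t} a)) (\<lambda>t. a t * exp (integral {0..t} a))"
    and "primitive_on T (\<lambda>t. exp (- integral {0..t} a)) (\<lambda>t. - a t * exp (- integral {0..t} a))"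
proof -
  have A: "primitive_on T (\<lambda>t. integral {0..t} a) a" by (rule primitive_on_integral[OF a])
  show "primitive_on T (\<lambda>t. exp (integral {0..t} a)) (\<lambda>t. a t * exp (integral {0..t} a))"
    by (rule primitive_on_exp[OF A])
  show "primitive_on T (\<lambda>t. exp (- integral {0..t} a)) (\<lambda>t. - a t * exp (- integral {0..t} a))"
    using primitive_on_exp[OF primitive_on_cmult[OF A, of "-1"]] by simp
qed

text \<open>Variation of constants with the integrating factor \<open>exp (A t)\<close>. The point
  \<open>t0\<close> is free, so the same formula provides states prescribed at time 0 and the
  adjoint variable prescribed at time \<open>T\<close>.\<close>

lemma linear_ode_exists:
  fixes b s0 t0 :: real
  assumes a: "bounded_measurable T a"
  obtains S where "S t0 = s0" "primitive_on T S (\<lambda>t. a t * S t + b)"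
proof -
  define A where "A = (\<lambda>t. integral {0..t} a)"
  have E: "primitive_on T (\<lambda>t. exp (A t)) (\<lambda>t. a t * exp (A t))"
    and E': "primitive_on T (\<lambda>t. exp (- A t)) (\<lambda>t. - a t * exp (- A t))"
    using linear_ode_integrating_factor[OF a] by (simp_all add: A_def)
  have "bounded_measurable T (\<lambda>t. b * exp (- A t))"
    by (intro bounded_measurable_intros bounded_measurable_continuous primitive_on_continuous[OF E'])
  then have I: "primitive_on T (\<lambda>t. integral {0..t} (\<lambda>t. b * exp (- A t))) (\<lambda>t. b * exp (- A t))"
    (is "primitive_on T ?I _")
    by (rule primitive_on_integral)
  \<comment> \<open>\<open>K\<close> solves \<open>exp (A t0) * (K + ?I t0) = s0\<close>.\<close>
  define K where "K = s0 * exp (- A t0) - ?I t0"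
  define S where "S = (\<lambda>t. exp (A t) * (K + ?I t))"
  have "primitive_on T S (\<lambda>t. a t * exp (A t) * (K + ?I t) + exp (A t) * (0 + b * exp (- A t)))"
    unfolding S_def by (intro primitive_on_mult primitive_on_add primitive_on_const E I)
  then have "primitive_on T S (\<lambda>t. a t * S t + b)"
    by (rule primitive_on_cong) (simp_all add: S_def exp_minus field_simps)
  moreover have "S t0 = s0"
    by (simp add: S_def K_def exp_minus field_simps)
  ultimately show thesis using that by blast
qed

text \<open>A Gronwall-type estimate: multiplying by \<open>exp (- A t)\<close> removes the term
  \<open>a t * D t\<close> and leaves the density \<open>f t * exp (- A t)\<close>. One factor
  \<open>exp (M * T)\<close> bounds this weight, the other arises when it is divided out
  again.\<close>

lemma linear_ode_bound:
  assumes D: "primitive_on T D (\<lambda>t. a t * D t + f t)" and a: "bounded_measurable T a"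
    and aM: "\<And>t. t \<in> {0..T} \<Longrightarrow> \<bar>a t\<bar> \<le> M"
    and fe: "\<And>t. t \<in> {0..T} \<Longrightarrow> \<bar>f t\<bar> \<le> e"
    and D0: "D 0 = 0" and t: "t \<in> {0..T}"
  shows "\<bar>D t\<bar> \<le> exp (2 * M * T) * T * e"
proof -
  define A where "A = (\<lambda>t. integral {0..t} a)"
  have E': "primitive_on T (\<lambda>t. exp (- A t)) (\<lambda>t. - a t * exp (- A t))"
    using linear_ode_integrating_factor[OF a] by (simp add: A_def)
  have M: "M \<ge> 0" and e: "e \<ge> 0" using aM[of t] fe[of t] t by force+
  have A_le: "\<bar>A s\<bar> \<le> M * T" if "s \<in> {0..T}" for s
  proof -
    have "\<bar>A s\<bar> \<le> M * (s - 0)"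
      unfolding A_def by (rule abs_integral_le) (use that aM bounded_measurable_integrable[OF a] in auto)
    also have "\<dots> \<le> M * T" using that M by (intro mult_left_mono) auto
    finally show ?thesis .
  qed
  have P: "primitive_on T (\<lambda>t. D t * exp (- A t)) (\<lambda>t. f t * exp (- A t))"
    by (rule primitive_on_cong[OF primitive_on_mult[OF D E']]) (simp_all add: algebra_simps)
  have "\<bar>integral {0..t} (\<lambda>t. f t * exp (- A t))\<bar> \<le> e * exp (M * T) * (t - 0)"
  proof (rule abs_integral_le)
    show "(\<lambda>t. f t * exp (- A t)) integrable_on {0..t}"
      by (rule bounded_measurable_integrable[OF primitive_on_bounded_measurable[OF P]]) (use t in auto)
    fix r assume "r \<in> {0..t}"
    then have "\<bar>f r\<bar> \<le> e" "exp (- A r) \<le> exp (M * T)" using fe[of r] A_le[of r] t by auto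
    then show "\<bar>f r * exp (- A r)\<bar> \<le> e * exp (M * T)"
      unfolding abs_mult using e by (intro mult_mono) auto
  qed (use t in auto)
  then have 1: "\<bar>D t\<bar> * exp (- A t) \<le> e * exp (M * T) * t"
    using primitive_on_increment[OF P, of 0 t] D0 t by (simp add: abs_mult)
  have "\<bar>D t\<bar> = (\<bar>D t\<bar> * exp (- A t)) * exp (A t)" by (simp add: exp_minus)
  also have "\<dots> \<le> (e * exp (M * T) * T) * exp (M * T)"
  proof (rule mult_mono)
    have "e * exp (M * T) * t \<le> e * exp (M * T) * T"
      using t e by (intro mult_left_mono) auto
    with 1 show "\<bar>D t\<bar> * exp (- A t) \<le> e * exp (M * T) * T" by linarith
    show "exp (A t) \<le> exp (M * T)" using A_le[OF t] by simp
  qed (use e t in auto)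
  also have "\<dots> = exp (2 * M * T) * T * e" by (simp add: mult_exp_exp)
  finally show ?thesis .
qed

subsection \<open>Maximum principle and structure of the switching function\<close>

text \<open>Exact, not merely first order, because the perturbed state \<open>S\<close> occurs on the right.\<close>
lemma cost_difference:
  assumes T: "T \<ge> 0" and u: "bounded_measurable T u" and v: "bounded_measurable T v"
    and R: "primitive_on T R (\<lambda>t. - u t * R t + c)" and S: "primitive_on T S (\<lambda>t. - v t * S t + c)"
    and init: "R 0 = S 0"
    and q: "primitive_on T q (\<lambda>t. u t * q t + - \<alpha>)" and qT: "q T = 0"
  shows "integral {0..T} (\<lambda>t. \<alpha> * S t + \<beta> * v t) - integral {0..T} (\<lambda>t. \<alpha> * R t + \<beta> * u t)
       = integral {0..T} (\<lambda>t. (\<beta> - q t * S t) * (v t - u t))"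
proof -
  \<comment> \<open>\<open>?k\<close> is the density of \<open>q * (S - R)\<close>, which vanishes
    at 0 by the common initial state and at \<open>T\<close> by \<open>q T = 0\<close>. Hence its
    integral is zero, and adding it to the cost difference cancels the terms in \<alpha>.\<close>
  let ?k = "\<lambda>t. - \<alpha> * (S t - R t) - q t * (v t - u t) * S t"
  have P: "primitive_on T (\<lambda>t. q t * (S t - R t)) ?k"
    by (rule primitive_on_cong[OF primitive_on_mult[OF q primitive_on_diff[OF S R]]])
      (simp_all add: algebra_simps)
  have bm: "bounded_measurable T R" "bounded_measurable T S" "bounded_measurable T q"
    by (intro bounded_measurable_continuous primitive_on_continuous[OF R]
        primitive_on_continuous[OF S] primitive_on_continuous[OF q])+
  have i: "f integrable_on {0..T}" if "bounded_measurable T f" for f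
    using bounded_measurable_integrable[OF that] by simp
  have "integral {0..T} ?k = 0"
    using primitive_on_increment[OF P, of 0 T] T qT init by simp
  moreover have "integral {0..T} (\<lambda>t. \<alpha> * S t + \<beta> * v t) - integral {0..T} (\<lambda>t. \<alpha> * R t + \<beta> * u t)
      = integral {0..T} (\<lambda>t. (\<alpha> * S t + \<beta> * v t) - (\<alpha> * R t + \<beta> * u t))"
    by (intro Henstock_Kurzweil_Integration.integral_diff[symmetric] i bounded_measurable_intros u v bm)
  moreover have "integral {0..T} (\<lambda>t. (\<beta> - q t * S t) * (v t - u t))
      = integral {0..T} (\<lambda>t. ((\<alpha> * S t + \<beta> * v t) - (\<alpha> * R t + \<beta> * u t)) + ?k t)"
    by (rule Henstock_Kurzweil_Integration.integral_cong) (simp add: algebra_simps)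
  moreover have "\<dots> = integral {0..T} (\<lambda>t. (\<alpha> * S t + \<beta> * v t) - (\<alpha> * R t + \<beta> * u t)) + integral {0..T} ?k"
    by (intro Henstock_Kurzweil_Integration.integral_add i bounded_measurable_intros u v bm)
  ultimately show ?thesis by simp
qed

lemma AE_zero_of_integral_zero:
  assumes f: "bounded_measurable T f" and nn: "\<And>t. t \<in> {0..T} \<Longrightarrow> 0 \<le> f t"
    and z: "integral {0..T} f = 0"
  shows "AE t in lebesgue. t \<in> {0..T} \<longrightarrow> f t = 0"
proof -
  have ai: "f absolutely_integrable_on {0..T}"
    using bounded_measurable_absolutely_integrable[OF f] by simp
  then have "(LINT t:{0..T}|lebesgue. f t) = 0"
    using set_lebesgue_integral_eq_integral(2)[OF ai] z by simp
  then have "AE t in lebesgue. indicator {0..T} t *\<^sub>R f t = 0"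
    using integral_nonneg_eq_0_iff_AE[of lebesgue "\<lambda>t. indicator {0..T} t *\<^sub>R f t"] ai nn
    by (auto simp: set_lebesgue_integral_def set_integrable_def indicator_def)
  then show ?thesis by eventually_elim (auto simp: indicator_def)
qed

text \<open>For the perturbed control the cost changes by \<epsilon> times the sum of minus the
  integral of \<open>f\<close> and an error of order \<epsilon>. Optimality makes this nonnegative,
  so the integral of \<open>f\<close> is at most of order \<epsilon>; as \<open>f\<close> is
  nonnegative, it vanishes almost everywhere.\<close>

lemma maximum_principle:
  assumes T: "T \<ge> 0" and u: "bounded_measurable T u"
    and u_le: "\<And>t. t \<in> {0..T} \<Longrightarrow> 0 \<le> u t \<and> u t \<le> u1"
    and R: "primitive_on T R (\<lambda>t. - u t * R t + c)"
    and q: "primitive_on T q (\<lambda>t. u t * q t + - \<alpha>)" and qT: "q T = 0"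
    and opt: "\<And>v S. bounded_measurable T v \<Longrightarrow> (\<And>t. t \<in> {0..T} \<Longrightarrow> 0 \<le> v t \<and> v t \<le> u1) \<Longrightarrow>
      primitive_on T S (\<lambda>t. - v t * S t + c) \<Longrightarrow> S 0 = R 0 \<Longrightarrow>
      integral {0..T} (\<lambda>t. \<alpha> * R t + \<beta> * u t) \<le> integral {0..T} (\<lambda>t. \<alpha> * S t + \<beta> * v t)"
  shows "AE t in lebesgue. t \<in> {0..T} \<longrightarrow>
    (q t * R t > \<beta> \<longrightarrow> u t = u1) \<and> (q t * R t < \<beta> \<longrightarrow> u t = 0)"
proof -
  \<comment> \<open>Where \<open>q R = \<beta>\<close> every control value gives the same
    Hamiltonian; keeping \<open>u\<close> there leaves the control unperturbed on that set.\<close>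
  define w where "w = (\<lambda>t. if q t * R t > \<beta> then u1 else if q t * R t < \<beta> then 0 else u t)"
  have cR: "continuous_on {0..T} R" and cq: "continuous_on {0..T} q"
    using primitive_on_continuous R q by auto
  have bR: "bounded_measurable T R" and bq: "bounded_measurable T q"
    using cR cq bounded_measurable_continuous by auto
  obtain MR where MR: "\<And>t. t \<in> {0..T} \<Longrightarrow> \<bar>R t\<bar> \<le> MR"
    using bR unfolding bounded_measurable_def by blast
  obtain Mq where Mq: "\<And>t. t \<in> {0..T} \<Longrightarrow> \<bar>q t\<bar> \<le> Mq"
    using bq unfolding bounded_measurable_def by blast
  have pos: "u1 \<ge> 0" "MR \<ge> 0" "Mq \<ge> 0" using u_le[of 0] MR[of 0] Mq[of 0] T by auto
  have w_le: "0 \<le> w t \<and> w t \<le> u1" if "t \<in> {0..T}" for t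
    using u_le[OF that] pos by (simp add: w_def)
  have w: "bounded_measurable T w"
  proof -
    have [measurable]: "q \<in> borel_measurable (lebesgue_on {0..T})" "R \<in> borel_measurable (lebesgue_on {0..T})"
      "u \<in> borel_measurable (lebesgue_on {0..T})"
      using bR bq u by (auto simp: bounded_measurable_def)
    have "w \<in> borel_measurable (lebesgue_on {0..T})" unfolding w_def by measurable
    moreover have "\<forall>t\<in>{0..T}. \<bar>w t\<bar> \<le> u1" using w_le by auto
    ultimately show ?thesis unfolding bounded_measurable_def by blast
  qed
  have i: "f integrable_on {0..T}" if "bounded_measurable T f" for f
    using bounded_measurable_integrable[OF that] by simp
  \<comment> \<open>This is \<open>(\<beta> - q R) (u - w)\<close>, the pointwise gain from
    replacing \<open>u\<close> by \<open>w\<close>; it is nonnegative by the choice of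
    \<open>w\<close>.\<close>
  define f where "f = (\<lambda>t. (q t * R t - \<beta>) * (w t - u t))"
  have f: "bounded_measurable T f"
    unfolding f_def by (intro bounded_measurable_intros bq bR w u)
  have f_nn: "0 \<le> f t" if "t \<in> {0..T}" for t
    using u_le[OF that] by (auto simp: f_def w_def mult_nonpos_nonpos)
  have wu: "\<bar>w t - u t\<bar> \<le> u1" if "t \<in> {0..T}" for t
    using u_le[OF that] w_le[OF that] by auto
  \<comment> \<open>The factors bound, in order, the absolute values of \<open>q\<close>, of
    \<open>(S - R) / \<epsilon>\<close> and of \<open>w - u\<close>; the last is the length of the
    interval.\<close>
  define C where "C = Mq * (exp (2 * u1 * T) * T * (u1 * MR)) * u1 * T"
  have bound: "integral {0..T} f \<le> C * \<epsilon>" if \<epsilon>: "0 < \<epsilon>" "\<epsilon> < 1" for \<epsilon>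
  proof -
    define v where "v = (\<lambda>t. u t + \<epsilon> * (w t - u t))"
    have v: "bounded_measurable T v" unfolding v_def by (intro bounded_measurable_intros u w)
    have v_le: "0 \<le> v t \<and> v t \<le> u1" if "t \<in> {0..T}" for t
    proof -
      have "v t = (1 - \<epsilon>) * u t + \<epsilon> * w t" by (simp add: v_def algebra_simps)
      moreover have "(1 - \<epsilon>) * u t + \<epsilon> * w t \<le> (1 - \<epsilon>) * u1 + \<epsilon> * u1"
        using u_le[OF that] w_le[OF that] \<epsilon> by (intro add_mono mult_left_mono) auto
      moreover have "0 \<le> (1 - \<epsilon>) * u t + \<epsilon> * w t"
        using u_le[OF that] w_le[OF that] \<epsilon> by (intro add_nonneg_nonneg mult_nonneg_nonneg) auto
      ultimately show ?thesis by (simp add: algebra_simps)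
    qed
    obtain S where S0: "S 0 = R 0" and S: "primitive_on T S (\<lambda>t. - v t * S t + c)"
      using linear_ode_exists[OF bounded_measurable_uminus[OF v], of 0 "R 0" c] by blast
    have bS: "bounded_measurable T S"
      by (intro bounded_measurable_continuous primitive_on_continuous[OF S])
    \<comment> \<open>The difference of the states starts at zero and solves a linear equation with
      forcing of order \<epsilon>, so it is itself of order \<epsilon>.\<close>
    have D: "primitive_on T (\<lambda>t. S t - R t) (\<lambda>t. - v t * (S t - R t) + - \<epsilon> * (w t - u t) * R t)"
      by (rule primitive_on_cong[OF primitive_on_diff[OF S R]]) (simp_all add: v_def algebra_simps)
    have SR: "\<bar>S t - R t\<bar> \<le> exp (2 * u1 * T) * T * (\<epsilon> * (u1 * MR))" if "t \<in> {0..T}" for t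
    proof (rule linear_ode_bound[OF D bounded_measurable_uminus[OF v]])
      show "\<bar>- v t\<bar> \<le> u1" if "t \<in> {0..T}" for t using v_le[OF that] by auto
      show "\<bar>- \<epsilon> * (w t - u t) * R t\<bar> \<le> \<epsilon> * (u1 * MR)" if "t \<in> {0..T}" for t
      proof -
        have "\<bar>w t - u t\<bar> * \<bar>R t\<bar> \<le> u1 * MR"
          using wu[OF that] MR[OF that] pos by (intro mult_mono) auto
        then show ?thesis using \<epsilon> by (simp add: abs_mult mult.assoc)
      qed
    qed (use that S0 in auto)
    \<comment> \<open>The correction for replacing the perturbed state \<open>S\<close> by
      \<open>R\<close> in the coefficient of \<open>w - u\<close>.\<close>
    let ?e = "\<lambda>t. (q t * (R t - S t)) * (w t - u t)"
    have e: "bounded_measurable T ?e" by (intro bounded_measurable_intros bq bR bS w u)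
    have "integral {0..T} (\<lambda>t. (\<beta> - q t * S t) * (v t - u t)) \<ge> 0"
      using cost_difference[OF T u v R S S0[symmetric] q qT, of \<beta>] opt[OF v v_le S S0] by simp
    also have "integral {0..T} (\<lambda>t. (\<beta> - q t * S t) * (v t - u t)) = integral {0..T} (\<lambda>t. \<epsilon> * (?e t - f t))"
      by (rule Henstock_Kurzweil_Integration.integral_cong) (simp add: v_def f_def algebra_simps)
    also have "\<dots> = \<epsilon> * (integral {0..T} ?e - integral {0..T} f)"
      by (simp add: Henstock_Kurzweil_Integration.integral_diff i e f)
    finally have "integral {0..T} f \<le> integral {0..T} ?e"
      using \<epsilon> by (simp add: zero_le_mult_iff)
    moreover have "\<bar>integral {0..T} ?e\<bar> \<le> (Mq * (exp (2 * u1 * T) * T * (\<epsilon> * (u1 * MR))) * u1) * (T - 0)"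
    proof (rule abs_integral_le[OF i[OF e] T])
      fix t assume t: "t \<in> {0..T}"
      have "\<bar>q t\<bar> * \<bar>R t - S t\<bar> * \<bar>w t - u t\<bar> \<le> Mq * (exp (2 * u1 * T) * T * (\<epsilon> * (u1 * MR))) * u1"
        using Mq[OF t] SR[OF t] wu[OF t] pos \<epsilon> T
        by (intro mult_mono) (auto simp: abs_minus_commute)
      then show "\<bar>?e t\<bar> \<le> Mq * (exp (2 * u1 * T) * T * (\<epsilon> * (u1 * MR))) * u1"
        by (simp only: abs_mult)
    qed
    ultimately show ?thesis by (simp add: C_def mult_ac)
  qed
  have "integral {0..T} f \<le> 0"
  proof (rule tendsto_lowerbound)
    show "((\<lambda>\<epsilon>. C * \<epsilon>) \<longlongrightarrow> 0) (at_right 0)" by (rule tendsto_eq_intros refl | simp)+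
    show "\<forall>\<^sub>F \<epsilon> in at_right 0. integral {0..T} f \<le> C * \<epsilon>"
      by (rule eventually_at_rightI[of 0 1]) (use bound in auto)
  qed auto
  moreover have "integral {0..T} f \<ge> 0"
    by (rule Henstock_Kurzweil_Integration.integral_nonneg[OF i[OF f] f_nn])
  ultimately have "AE t in lebesgue. t \<in> {0..T} \<longrightarrow> f t = 0"
    by (intro AE_zero_of_integral_zero[OF f f_nn]) auto
  \<comment> \<open>Where \<open>q R\<close> differs from \<beta>, \<open>f t = 0\<close> forces
    \<open>u t = w t\<close>.\<close>
  then show ?thesis
    by eventually_elim (auto simp: f_def w_def split: if_splits)
qed

section \<open>Shape of the switching function\<close>

text \<open>A continuous density is a genuine two-sided derivative at interior points, by the
  fundamental theorem of calculus. This serves the switching function, whose density contains no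
  control.\<close>

lemma primitive_on_has_derivative:
  assumes F: "primitive_on T F f" and c: "continuous_on {0..T} f" and t: "0 < t" "t < T"
  shows "(F has_real_derivative f t) (at t)"
proof -
  have "((\<lambda>x. F 0 + integral {0..x} f) has_real_derivative 0 + f t) (at t within {0..T})"
    by (intro DERIV_add DERIV_const integral_has_real_derivative c) (use t in auto)
  then have "((\<lambda>x. F 0 + integral {0..x} f) has_real_derivative f t) (at t within {0<..<T})"
    by (auto elim!: DERIV_subset)
  then have "((\<lambda>x. F 0 + integral {0..x} f) has_real_derivative f t) (at t)"
    by (subst (asm) at_within_open) (use t in auto)
  then show ?thesis
  proof (rule has_field_derivative_transform_within_open[of _ _ _ "{0<..<T}"])
    fix x assume "x \<in> {0<..<T}"
    then show "F 0 + integral {0..x} f = F x"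
      using primitive_on_increment[OF F, of 0 x] by simp
  qed (use t in auto)
qed

text \<open>At an interior minimum \<open>h m = 0\<close>, and then \<open>small\<close> keeps the
  density of \<open>h\<close> below a negative constant just to the right of \<open>m\<close>,
  whatever values the control takes there. So \<open>h\<close> turns negative and \<open>g\<close>
  drops below \<open>g m\<close>. Integrating the density replaces the second derivative test, as
  \<open>u\<close> is only measurable.\<close>

lemma no_interior_minimum:
  assumes G: "primitive_on T g h" and H: "primitive_on T h (\<lambda>t. u t * w t - \<kappa>)"
    and w: "continuous_on {0..T} w"
    and u_le: "\<And>t. t \<in> {0..T} \<Longrightarrow> 0 \<le> u t \<and> u t \<le> u1"
    and m: "0 \<le> a" "a < m" "m < d" "d \<le> T"
    and min: "\<And>t. t \<in> {a..d} \<Longrightarrow> g m \<le> g t"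
    and small: "h m = 0 \<Longrightarrow> u1 * \<bar>w m\<bar> < \<kappa>"
  shows False
proof -
  have ch: "continuous_on {0..T} h" by (rule primitive_on_continuous[OF H])
  have der: "(g has_real_derivative h t) (at t)" if "0 < t" "t < T" for t
    by (rule primitive_on_has_derivative[OF G ch that])
  have hm: "h m = 0"
  proof (rule DERIV_local_min[OF der])
    show "0 < min (m - a) (d - m)" using m by simp
    show "\<forall>y. \<bar>m - y\<bar> < min (m - a) (d - m) \<longrightarrow> g m \<le> g y"
    proof (intro allI impI)
      fix y assume "\<bar>m - y\<bar> < min (m - a) (d - m)"
      then have "y \<in> {a..d}" by auto
      then show "g m \<le> g y" by (rule min)
    qed
  qed (use m in auto)
  have u1: "u1 \<ge> 0" using u_le[of m] m by auto
  have "((\<lambda>t. u1 * \<bar>w t\<bar>) \<longlongrightarrow> u1 * \<bar>w m\<bar>) (at m within {0..T})"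
    using w m by (intro tendsto_intros) (auto simp: continuous_on_def)
  then have "\<forall>\<^sub>F t in at m within {0..T}. u1 * \<bar>w t\<bar> < \<kappa>"
    using small[OF hm] order_tendstoD(2) by blast
  then obtain \<delta> where \<delta>: "\<delta> > 0" "\<And>t. t \<in> {0..T} \<Longrightarrow> t \<noteq> m \<Longrightarrow> dist t m < \<delta> \<Longrightarrow> u1 * \<bar>w t\<bar> < \<kappa>"
    by (auto simp: eventually_at)
  \<comment> \<open>Halving keeps \<open>e\<close> strictly below both \<open>d\<close> and
    \<open>m + \<delta>\<close>.\<close>
  define e where "e = m + min \<delta> (d - m) / 2"
  have e: "m < e" "e < d" "e < m + \<delta>" using \<delta>(1) m by (auto simp: e_def min_def field_simps)
  \<comment> \<open>Compactness turns the pointwise strict inequality into the uniform margin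
    \<open>\<eta>\<close>.\<close>
  have "\<exists>x\<in>{m..e}. \<forall>t\<in>{m..e}. u1 * \<bar>w t\<bar> \<le> u1 * \<bar>w x\<bar>"
    by (rule continuous_attains_sup)
      (use m e in \<open>auto intro!: continuous_intros continuous_on_subset[OF w]\<close>)
  then obtain x where x: "x \<in> {m..e}" "\<And>t. t \<in> {m..e} \<Longrightarrow> u1 * \<bar>w t\<bar> \<le> u1 * \<bar>w x\<bar>" by blast
  define \<eta> where "\<eta> = \<kappa> - u1 * \<bar>w x\<bar>"
  have \<eta>: "\<eta> > 0"
    using \<delta>(2)[of x] small[OF hm] x(1) m e by (cases "x = m") (auto simp: dist_real_def \<eta>_def)
  have k_neg: "u t * w t - \<kappa> \<le> - \<eta>" if "t \<in> {m..e}" for t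
  proof -
    have t: "t \<in> {0..T}" using that m e by auto
    have "u t * w t \<le> u t * \<bar>w t\<bar>" using u_le[OF t] by (intro mult_left_mono) auto
    also have "\<dots> \<le> u1 * \<bar>w t\<bar>" using u_le[OF t] by (intro mult_right_mono) auto
    also have "\<dots> \<le> u1 * \<bar>w x\<bar>" by (rule x(2)[OF that])
    finally show ?thesis by (simp add: \<eta>_def)
  qed
  have h_neg: "h t < 0" if "m < t" "t \<le> e" for t
  proof -
    have "h t - h m = integral {m..t} (\<lambda>t. u t * w t - \<kappa>)"
      by (rule primitive_on_increment[OF H]) (use that m e in auto)
    also have "\<dots> \<le> integral {m..t} (\<lambda>_. - \<eta>)"
      by (rule integral_le)
        (use that m e k_neg in \<open>auto intro!: bounded_measurable_integrable[OF primitive_on_bounded_measurable[OF H]]\<close>)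
    also have "\<dots> < 0" using that \<eta> by simp
    finally show ?thesis using hm by simp
  qed
  obtain z where z: "m < z" "z < e" "g e - g m = (e - m) * h z"
    using MVT2[of m e g h] der m e by (metis less_le_trans le_less_trans order_less_imp_le)
  have "(e - m) * h z < 0" using z h_neg[of z] e by (intro mult_pos_neg) auto
  moreover have "g m \<le> g e" using min[of e] m e by auto
  ultimately show False using z(3) by simp
qed

text \<open>With \<open>g = q R\<close>, \<open>h = c q - \<alpha> R\<close> and \<open>w = c q + \<alpha> R\<close> one has \<open>g' = h\<close>,
  \<open>h' = u w - 2 \<alpha> c\<close> and \<open>w\<^sup>2 = h\<^sup>2 + 4 \<alpha> c g\<close>. Where \<open>h = 0\<close> and \<open>g \<le> \<beta>\<close>,
  the bound on \<open>u1\<close> forces \<open>h' < 0\<close>.\<close>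
lemma superlevel_convex:
  assumes T: "T > 0" and u_le: "\<And>t. t \<in> {0..T} \<Longrightarrow> 0 \<le> u t \<and> u t \<le> u1" and u1: "u1 > 0"
    and R: "primitive_on T R (\<lambda>t. - u t * R t + c)"
    and q: "primitive_on T q (\<lambda>t. u t * q t + - \<alpha>)"
    and pos: "\<alpha> > 0" "\<beta> > 0" "c > 0" and nonsingular: "u1\<^sup>2 * \<beta> < \<alpha> * c"
    and ends: "q a * R a \<ge> \<beta>" "q d * R d \<ge> \<beta>" and b: "0 \<le> a" "a < b" "b < d" "d \<le> T"
  shows "q b * R b > \<beta>"
proof (rule ccontr)
  define g where "g = (\<lambda>t. q t * R t)"
  define h where "h = (\<lambda>t. c * q t - \<alpha> * R t)"
  define w where "w = (\<lambda>t. c * q t + \<alpha> * R t)"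
  have G: "primitive_on T g h"
    unfolding g_def by (rule primitive_on_cong[OF primitive_on_mult[OF q R]]) (simp_all add: h_def algebra_simps)
  have H: "primitive_on T h (\<lambda>t. u t * w t - 2 * \<alpha> * c)"
    unfolding h_def by (rule primitive_on_cong[OF primitive_on_diff[OF primitive_on_cmult[OF q, of c] primitive_on_cmult[OF R, of \<alpha>]]])
      (simp_all add: w_def algebra_simps)
  have w: "continuous_on {0..T} w"
    unfolding w_def by (intro continuous_intros primitive_on_continuous[OF q] primitive_on_continuous[OF R])
  assume "\<not> q b * R b > \<beta>"
  then have gb: "g b \<le> \<beta>" by (simp add: g_def)
  have "\<exists>m\<in>{a..d}. \<forall>t\<in>{a..d}. g m \<le> g t"
    by (rule continuous_attains_inf)
      (use b in \<open>auto intro!: continuous_on_subset[OF primitive_on_continuous[OF G]]\<close>)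
  then obtain m' where m': "m' \<in> {a..d}" "\<And>t. t \<in> {a..d} \<Longrightarrow> g m' \<le> g t" by blast
  \<comment> \<open>If the minimum is attained at an endpoint, its value is at least \<beta> and
    hence at least \<open>g b\<close>, so \<open>b\<close> is a minimizer too. Either way
    \<open>m\<close> is an interior minimizer.\<close>
  define m where "m = (if a < m' \<and> m' < d then m' else b)"
  have min: "g m \<le> g t" if "t \<in> {a..d}" for t
  proof (cases "a < m' \<and> m' < d")
    case False
    then have "m' = a \<or> m' = d" using m' by auto
    then have "g m' \<ge> \<beta>" using ends by (auto simp: g_def)
    then show ?thesis using gb m'(2)[OF that] False by (simp add: m_def)
  qed (use m' that in \<open>simp add: m_def\<close>)
  have m: "a < m" "m < d" using b by (auto simp: m_def)
  have gm: "g m \<le> \<beta>" using min[of b] gb b by auto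
  show False
  proof (rule no_interior_minimum[OF G H w u_le b(1) m b(4) min])
    assume h: "h m = 0"
    \<comment> \<open>With \<open>h m = 0\<close> and \<open>g m \<le> \<beta>\<close> this bounds
      \<open>w m\<close>, and \<open>nonsingular\<close> is exactly what makes
      \<open>u1 * \<bar>w m\<bar>\<close> smaller than the constant \<open>2 * \<alpha> * c\<close>;
      squares are compared to avoid roots.\<close>
    have "(w m)\<^sup>2 = (h m)\<^sup>2 + 4 * \<alpha> * c * g m"
      by (simp add: w_def h_def g_def power2_eq_square algebra_simps)
    also have "\<dots> \<le> 4 * \<alpha> * c * \<beta>" using h gm pos by simp
    finally have "u1\<^sup>2 * (w m)\<^sup>2 \<le> u1\<^sup>2 * (4 * \<alpha> * c * \<beta>)" by (intro mult_left_mono) auto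
    also have "\<dots> = 4 * \<alpha> * c * (u1\<^sup>2 * \<beta>)" by simp
    also have "\<dots> < 4 * \<alpha> * c * (\<alpha> * c)" using pos nonsingular by (intro mult_strict_left_mono) auto
    finally have "(u1 * \<bar>w m\<bar>)\<^sup>2 < (2 * \<alpha> * c)\<^sup>2"
      by (simp add: power_mult_distrib power2_eq_square mult_ac)
    then show "u1 * \<bar>w m\<bar> < 2 * \<alpha> * c" by (rule power_less_imp_less_base) (use pos in simp)
  qed
qed

section \<open>From the superlevel set to the switching times\<close>

text \<open>The set where \<open>g \<ge> \<beta>\<close> is compact; between its first point
  \<open>s1\<close> and last point \<open>s2\<close>, \<open>conv\<close> gives
  \<open>g > \<beta>\<close>, and outside them \<open>g < \<beta>\<close>. The three forms
  correspond to an empty or one-point set, to \<open>s1 = 0 < s2\<close>, and to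
  \<open>0 < s1 < s2\<close>.\<close>

lemma bang_bang_form:
  fixes g u :: "real \<Rightarrow> real"
  assumes T: "T > 0" and g: "continuous_on {0..T} g" and gT: "g T < \<beta>"
    and conv: "\<And>a b d. 0 \<le> a \<Longrightarrow> a < b \<Longrightarrow> b < d \<Longrightarrow> d \<le> T \<Longrightarrow> g a \<ge> \<beta> \<Longrightarrow> g d \<ge> \<beta> \<Longrightarrow> g b > \<beta>"
    and ae: "AE t in lebesgue. t \<in> {0..T} \<longrightarrow> (g t > \<beta> \<longrightarrow> u t = u1) \<and> (g t < \<beta> \<longrightarrow> u t = 0)"
  shows "\<exists>t1 t2. 0 < t1 \<and> t1 < t2 \<and> t2 < T \<and>
    ((AE t in lebesgue. t \<in> {0<..<T} \<longrightarrow> u t = 0) \<or>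
     (AE t in lebesgue. (t \<in> {0<..<t1} \<longrightarrow> u t = u1) \<and> (t \<in> {t1<..<T} \<longrightarrow> u t = 0)) \<or>
     (AE t in lebesgue. (t \<in> {0<..<t1} \<longrightarrow> u t = 0) \<and> (t \<in> {t1<..<t2} \<longrightarrow> u t = u1)
                        \<and> (t \<in> {t2<..<T} \<longrightarrow> u t = 0)))"
proof -
  let ?A = "{t \<in> {0..T}. g t \<ge> \<beta>}"
  \<comment> \<open>The switching times are quantified outside the disjunction, so the form without
    switchings also needs witnesses; any two ordered interior points serve.\<close>
  have off: ?thesis if "AE t in lebesgue. t \<in> {0<..<T} \<longrightarrow> u t = 0"
    using that T by (intro exI[of _ "T / 3"] exI[of _ "2 * T / 3"]) auto
  show ?thesis
  proof (cases "?A = {}")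
    case True
    then have "g t < \<beta>" if "t \<in> {0..T}" for t using that by force
    with ae have "AE t in lebesgue. t \<in> {0<..<T} \<longrightarrow> u t = 0"
      by (auto elim!: eventually_mono)
    then show ?thesis by (rule off)
  next
    case False
    have "closed ?A"
      using continuous_closed_preimage[OF g, of "{\<beta>..}"] by (simp add: vimage_def Int_def)
    moreover have "bounded ?A" by (rule bounded_subset[of "{0..T}"]) auto
    ultimately have A: "compact ?A" by (simp add: compact_eq_bounded_closed)
    obtain s1 where s1: "s1 \<in> ?A" "\<And>t. t \<in> ?A \<Longrightarrow> s1 \<le> t"
      using compact_attains_inf[OF A False] by blast
    obtain s2 where s2: "s2 \<in> ?A" "\<And>t. t \<in> ?A \<Longrightarrow> t \<le> s2"
      using compact_attains_sup[OF A False] by blast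
    \<comment> \<open>The value of \<open>g\<close> at \<open>T\<close> lies below \<beta>, which
      leaves a final piece with zero control.\<close>
    have "s2 \<noteq> T" using s2 gT by auto
    then have s2T: "s2 < T" using s2 by auto
    have s12: "s1 \<le> s2" "0 \<le> s1" using s1 s2 by auto
    have below: "g t < \<beta>" if "t \<in> {0..T}" "t < s1 \<or> t > s2" for t
      using that s1(2)[of t] s2(2)[of t] by force
    have above: "g t > \<beta>" if "s1 < t" "t < s2" for t
      using conv[of s1 t s2] s1 s2 that by auto
    have ae': "AE t in lebesgue. (t \<in> {0..T} \<and> (t < s1 \<or> t > s2) \<longrightarrow> u t = 0)
        \<and> (t \<in> {s1<..<s2} \<longrightarrow> u t = u1)"
      using ae
    proof eventually_elim
      case (elim t)
      have "t \<in> {0..T}" if "t \<in> {s1<..<s2}" using that s12 s2T by auto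
      then show ?case using elim below[of t] above[of t] by auto
    qed
    consider "s1 = s2" | "s1 = 0" "s1 < s2" | "0 < s1" "s1 < s2" using s12 by linarith
    then show ?thesis
    proof cases
      case 1
      \<comment> \<open>Touching the level \<beta> at a single point affects the control only on a
        null set.\<close>
      have "AE t in lebesgue. t \<notin> {s1}"
        by (rule AE_not_in) (simp add: negligible_iff_null_sets[symmetric])
      then have "AE t in lebesgue. t \<in> {0<..<T} \<longrightarrow> u t = 0"
        using ae' by eventually_elim (use 1 in auto)
      then show ?thesis by (rule off)
    next
      case 2
      have "AE t in lebesgue. (t \<in> {0<..<s2} \<longrightarrow> u t = u1) \<and> (t \<in> {s2<..<T} \<longrightarrow> u t = 0)"
        using ae' by eventually_elim (use 2 in auto)
      \<comment> \<open>There is one switching, at \<open>s2\<close>; the midpoint is a placeholder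
        for \<open>t2\<close>.\<close>
      then show ?thesis using 2 s2T by (intro exI[of _ s2] exI[of _ "(s2 + T) / 2"]) auto
    next
      case 3
      have "AE t in lebesgue. (t \<in> {0<..<s1} \<longrightarrow> u t = 0) \<and> (t \<in> {s1<..<s2} \<longrightarrow> u t = u1)
          \<and> (t \<in> {s2<..<T} \<longrightarrow> u t = 0)"
        using ae' by eventually_elim (use 3 s2T in auto)
      then show ?thesis using 3 s2T by (intro exI[of _ s1] exI[of _ s2]) auto
    qed
  qed
qed

subsection \<open>Reduction to controls bounded everywhere\<close>

text \<open>Clamping selects a representative of the control that obeys the bounds everywhere on the
  interval, as the pointwise estimates require.\<close>

lemma admissible_clamp:
  assumes "admissible T u1 u" "u1 > 0"
  defines "u' \<equiv> \<lambda>t. max 0 (min u1 (u t))"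
  shows "bounded_measurable T u'"
    and "AE t in lebesgue. t \<in> {0..T} \<longrightarrow> u t = u' t"
proof -
  have "u \<in> borel_measurable (lebesgue_on {0..T})"
    using assms(1) by (simp add: admissible_def set_borel_measurable_def borel_measurable_restrict_space_iff)
  then have "u' \<in> borel_measurable (lebesgue_on {0..T})" unfolding u'_def by measurable
  moreover have "\<forall>t\<in>{0..T}. \<bar>u' t\<bar> \<le> u1" using assms(2) by (auto simp: u'_def)
  ultimately show "bounded_measurable T u'" unfolding bounded_measurable_def by blast
  have "AE t in lebesgue. t \<in> {0..T} \<longrightarrow> 0 \<le> u t \<and> u t \<le> u1"
    using assms(1) by (simp add: admissible_def)
  then show "AE t in lebesgue. t \<in> {0..T} \<longrightarrow> u t = u' t"
    by eventually_elim (auto simp: u'_def)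
qed

lemma admissible_of_bounded_measurable:
  assumes "bounded_measurable T v" "\<And>t. t \<in> {0..T} \<Longrightarrow> 0 \<le> v t \<and> v t \<le> u1"
  shows "admissible T u1 v"
  using assms by (simp add: admissible_def set_borel_measurable_def bounded_measurable_def
      borel_measurable_restrict_space_iff)

text \<open>The bridge from the Lebesgue integrals of the problem statement to the
  \<open>integral\<close> used in the calculus above, absorbing a change of the integrand on a null
  set.\<close>

lemma set_integral_eq_integral_of_AE:
  assumes f: "bounded_measurable T f" and "0 \<le> t" "t \<le> T"
    and ae: "AE s in lebesgue. s \<in> {0..T} \<longrightarrow> f s = g s"
    and g: "set_borel_measurable lebesgue {0..t} g"
  shows "(LINT s:{0..t}|lebesgue. g s) = integral {0..t} f"
proof -
  have ai: "f absolutely_integrable_on {0..t}"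
    using bounded_measurable_absolutely_integrable[OF f] assms(3) by simp
  have "(LINT s:{0..t}|lebesgue. g s) = (LINT s:{0..t}|lebesgue. f s)"
    unfolding set_lebesgue_integral_def
  proof (rule integral_cong_AE)
    show "AE s in lebesgue. indicat_real {0..t} s *\<^sub>R g s = indicat_real {0..t} s *\<^sub>R f s"
      using ae by eventually_elim (use assms(3) in \<open>auto simp: indicator_def\<close>)
  qed (use g ai in \<open>auto simp: set_borel_measurable_def set_integrable_def\<close>)
  also have "\<dots> = integral {0..t} f"
    by (rule set_lebesgue_integral_eq_integral(2)[OF ai])
  finally show ?thesis .
qed

text \<open>Changing the control on a null set leaves the integral equation intact, so the state
  \<open>R\<close> also belongs to the representative \<open>u'\<close>.\<close>

lemma is_state_imp_primitive_on:
  assumes st: "is_state T N \<sigma> R0 u R" and T: "T \<ge> 0"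
    and u': "bounded_measurable T u'" and ae: "AE t in lebesgue. t \<in> {0..T} \<longrightarrow> u t = u' t"
  shows "primitive_on T R (\<lambda>t. - u' t * R t + real N * \<sigma>\<^sup>2)" and "R 0 = R0"
proof -
  let ?f = "\<lambda>t. - u' t * R t + real N * \<sigma>\<^sup>2" and ?g = "\<lambda>t. - u t * R t + real N * \<sigma>\<^sup>2"
  have R: "bounded_measurable T R"
    using st by (intro bounded_measurable_continuous) (simp add: is_state_def)
  have f: "bounded_measurable T ?f" by (intro bounded_measurable_intros u' R)
  have eq: "R t = R0 + integral {0..t} ?f" if t: "t \<in> {0..T}" for t
  proof -
    have "R t = R0 + (LINT s:{0..t}|lebesgue. ?g s)" and si: "set_integrable lebesgue {0..t} ?g"
      using st t by (auto simp: is_state_def)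
    moreover have "(LINT s:{0..t}|lebesgue. ?g s) = integral {0..t} ?f"
    proof (rule set_integral_eq_integral_of_AE[OF f])
      show "AE s in lebesgue. s \<in> {0..T} \<longrightarrow> ?f s = ?g s"
        using ae by eventually_elim auto
      show "set_borel_measurable lebesgue {0..t} ?g"
        using si by (simp add: set_integrable_def set_borel_measurable_def)
    qed (use t in auto)
    ultimately show ?thesis by simp
  qed
  show "R 0 = R0" using eq[of 0] T by simp
  then show "primitive_on T R ?f" using eq f unfolding primitive_on_def by metis
qed

text \<open>Turns perturbed trajectories into competitors of the original problem: a bounded
  measurable density is absolutely integrable, so both integrals agree.\<close>

lemma primitive_on_imp_is_state:
  assumes S: "primitive_on T S (\<lambda>t. - v t * S t + real N * \<sigma>\<^sup>2)"
  shows "is_state T N \<sigma> (S 0) v S"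
  unfolding is_state_def
proof (intro conjI ballI primitive_on_continuous[OF S])
  fix t assume t: "t \<in> {0..T}"
  show ai: "set_integrable lebesgue {0..t} (\<lambda>t. - v t * S t + real N * \<sigma>\<^sup>2)"
    by (rule bounded_measurable_absolutely_integrable[OF primitive_on_bounded_measurable[OF S]])
      (use t in auto)
  show "S t = S 0 + (LINT s:{0..t}|lebesgue. - v s * S s + real N * \<sigma>\<^sup>2)"
    using primitive_on_increment[OF S, of 0 t] t set_lebesgue_integral_eq_integral(2)[OF ai] by simp
qed

lemma cost_eq_integral:
  assumes T: "T \<ge> 0" and R: "continuous_on {0..T} R"
    and u': "bounded_measurable T u'" and ae: "AE t in lebesgue. t \<in> {0..T} \<longrightarrow> u t = u' t"
    and u: "set_borel_measurable lebesgue {0..T} u"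
  shows "cost T \<alpha> \<beta> u R = integral {0..T} (\<lambda>t. \<alpha> * R t + \<beta> * u' t)"
  unfolding cost_def
proof (rule set_integral_eq_integral_of_AE[where T=T])
  have bR: "bounded_measurable T R" by (rule bounded_measurable_continuous[OF R])
  show "bounded_measurable T (\<lambda>t. \<alpha> * R t + \<beta> * u' t)"
    by (intro bounded_measurable_intros bR u')
  show "AE s in lebesgue. s \<in> {0..T} \<longrightarrow> \<alpha> * R s + \<beta> * u' s = \<alpha> * R s + \<beta> * u s"
    using ae by eventually_elim auto
  have [measurable]: "R \<in> borel_measurable (lebesgue_on {0..T})" "u \<in> borel_measurable (lebesgue_on {0..T})"
    using bR u by (auto simp: bounded_measurable_def set_borel_measurable_def borel_measurable_restrict_space_iff)
  have "(\<lambda>s. \<alpha> * R s + \<beta> * u s) \<in> borel_measurable (lebesgue_on {0..T})" by measurable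
  then show "set_borel_measurable lebesgue {0..T} (\<lambda>s. \<alpha> * R s + \<beta> * u s)"
    by (simp add: set_borel_measurable_def borel_measurable_restrict_space_iff)
qed (use T in auto)

section \<open>Switching structure of optimal controls\<close>

theorem theorem1:
  fixes T \<alpha> \<beta> \<sigma> u1 R0 :: real and N :: nat and u :: "real \<Rightarrow> real"
  assumes "T > 0" "\<alpha> > 0" "\<beta> > 0" "\<sigma> > 0" "u1 > 0" "N \<ge> 1" "R0 \<ge> 0"
    and "sqrt (\<alpha> * real N * \<sigma>\<^sup>2 / \<beta>) > u1"
    and "optimal_control T \<alpha> \<beta> \<sigma> u1 N R0 u"
  shows "\<exists>t1 t2. 0 < t1 \<and> t1 < t2 \<and> t2 < T \<and>
    ((AE t in lebesgue. t \<in> {0<..<T} \<longrightarrow> u t = 0) \<or>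
     (AE t in lebesgue. (t \<in> {0<..<t1} \<longrightarrow> u t = u1) \<and> (t \<in> {t1<..<T} \<longrightarrow> u t = 0)) \<or>
     (AE t in lebesgue. (t \<in> {0<..<t1} \<longrightarrow> u t = 0) \<and> (t \<in> {t1<..<t2} \<longrightarrow> u t = u1)
                        \<and> (t \<in> {t2<..<T} \<longrightarrow> u t = 0)))"
proof -
  define c where "c = real N * \<sigma>\<^sup>2"
  have c: "c > 0" using assms by (simp add: c_def)
  \<comment> \<open>Squaring brings the hypothesis on \<open>u1\<close> into the polynomial form
    that excludes low interior minima of \<open>q R\<close>.\<close>
  have "u1\<^sup>2 < (sqrt (\<alpha> * c / \<beta>))\<^sup>2"
    using assms by (intro power_strict_mono) (auto simp: c_def mult.assoc)
  also have "\<dots> = \<alpha> * c / \<beta>" using assms c by simp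
  finally have nonsingular: "u1\<^sup>2 * \<beta> < \<alpha> * c" using assms by (simp add: pos_less_divide_eq)
  obtain R where adm: "admissible T u1 u" and R: "is_state T N \<sigma> R0 u R"
    and opt: "\<And>v S. admissible T u1 v \<Longrightarrow> is_state T N \<sigma> R0 v S \<Longrightarrow> cost T \<alpha> \<beta> u R \<le> cost T \<alpha> \<beta> v S"
    using assms(9) unfolding optimal_control_def by blast
  \<comment> \<open>The clamped control has the same state and the same cost, so it inherits the
    optimality of \<open>u\<close>.\<close>
  define u' where "u' = (\<lambda>t. max 0 (min u1 (u t)))"
  have u': "bounded_measurable T u'" and ae: "AE t in lebesgue. t \<in> {0..T} \<longrightarrow> u t = u' t"
    using admissible_clamp[OF adm] assms by (auto simp: u'_def)
  have u'_le: "0 \<le> u' t \<and> u' t \<le> u1" for t using assms by (auto simp: u'_def)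
  have PR: "primitive_on T R (\<lambda>t. - u' t * R t + c)" and R0: "R 0 = R0"
    using is_state_imp_primitive_on[OF R _ u' ae] assms by (auto simp: c_def)
  \<comment> \<open>There is no terminal cost, so the adjoint variable ends at zero; this also gives
    \<open>q R = 0 < \<beta>\<close> at time \<open>T\<close>.\<close>
  obtain q where qT: "q T = 0" and q: "primitive_on T q (\<lambda>t. u' t * q t + - \<alpha>)"
    using linear_ode_exists[OF u', of T 0 "- \<alpha>"] by blast
  have cost_u: "cost T \<alpha> \<beta> u R = integral {0..T} (\<lambda>t. \<alpha> * R t + \<beta> * u' t)"
    by (rule cost_eq_integral[OF _ primitive_on_continuous[OF PR] u' ae])
      (use assms adm in \<open>auto simp: admissible_def\<close>)
  have mp: "AE t in lebesgue. t \<in> {0..T} \<longrightarrow>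
      (q t * R t > \<beta> \<longrightarrow> u' t = u1) \<and> (q t * R t < \<beta> \<longrightarrow> u' t = 0)"
  proof (rule maximum_principle[OF _ u' u'_le PR q qT])
    fix v S assume v: "bounded_measurable T v" and v_le: "\<And>t. t \<in> {0..T} \<Longrightarrow> 0 \<le> v t \<and> v t \<le> u1"
      and S: "primitive_on T S (\<lambda>t. - v t * S t + c)" and S0: "S 0 = R 0"
    have adm_v: "admissible T u1 v" by (rule admissible_of_bounded_measurable[OF v v_le])
    have "is_state T N \<sigma> R0 v S"
      using primitive_on_imp_is_state[of T S v N \<sigma>] S S0 R0 by (simp add: c_def)
    then have "cost T \<alpha> \<beta> u R \<le> cost T \<alpha> \<beta> v S" by (rule opt[OF adm_v])
    also have "cost T \<alpha> \<beta> v S = integral {0..T} (\<lambda>t. \<alpha> * S t + \<beta> * v t)"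
      by (rule cost_eq_integral[OF _ primitive_on_continuous[OF S] v])
        (use assms adm_v in \<open>auto simp: admissible_def\<close>)
    finally show "integral {0..T} (\<lambda>t. \<alpha> * R t + \<beta> * u' t) \<le> integral {0..T} (\<lambda>t. \<alpha> * S t + \<beta> * v t)"
      by (simp add: cost_u)
  qed (use assms in auto)
  show ?thesis
  proof (rule bang_bang_form[where g="\<lambda>t. q t * R t" and \<beta>=\<beta>])
    show "continuous_on {0..T} (\<lambda>t. q t * R t)"
      by (intro continuous_intros primitive_on_continuous[OF q] primitive_on_continuous[OF PR])
    show "q b * R b > \<beta>" if "0 \<le> a" "a < b" "b < d" "d \<le> T" "q a * R a \<ge> \<beta>" "q d * R d \<ge> \<beta>" for a b d
      by (rule superlevel_convex[OF assms(1) u'_le assms(5) PR q assms(2,3) c nonsingular that(5,6,1-4)])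
    show "AE t in lebesgue. t \<in> {0..T} \<longrightarrow>
        (q t * R t > \<beta> \<longrightarrow> u t = u1) \<and> (q t * R t < \<beta> \<longrightarrow> u t = 0)"
      using mp ae by eventually_elim simp
  qed (use assms qT in auto)
qed

end
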